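(* Consider the Markov decision process (MDP) with a safety objective with state space $S=\{x,y,z,s^*\}$, where $s^*$ is the state to be avoided, initial state $x$, and the following actions and transitions. In state $x$ there are two actions $a$ and $b$: action $a$ leads to $s^*$ with probability $\frac12$ and to $x$ with probability $\frac12$; action $b$ leads to $y$ with probability 1. In state $y$ there is a single action $d$, which leads to $s^*$ with probability $\frac34$ and to $z$ with probability $\frac14$. In state $z$ there is a single action $e$, which leads to $s^*$ with probability $\frac12$ and to $z$ with probability $\frac12$. State $s^*$ is absorbing. In this MDP there exists no overtaking optimal strategy (in the sense of the safety objective, at the initial state $x$).
   Context: Play runs over periods $1,2,3,\ldots$, starting at period 1 in the initial state $s_1=x$; at each period $t$ the decision maker chooses an action $a_t$ available in the current state $s_t$ and $s_{t+1}$ is drawn according to the transition probabilities of $(s_t,a_t)$. A strategy $\sigma$ assigns to each finite history $(s_1,a_1,\ldots,s_{t-1},a_{t-1},s_t)$ (with all transitions having positive probability) a probability distribution on the actions available in $s_t$; randomization and history dependence are allowed. $\mathbb{P}_{s\sigma}$ denotes the probability measure on infinite histories induced by initial state $s$ and strategy $\sigma$. Let $t^*$ be the first period at which the state is $s^*$ ($t^*=\infty$ if $s^*$ is never reached). For the safety objective, a strategy $\sigma$ overtakes a strategy $\sigma'$ at the initial state $s$ if there is $T\in\mathbb{N}$ such that $\mathbb{P}_{s\sigma}(t^*\leq t)<\mathbb{P}_{s\sigma'}(t^*\leq t)$ for all $t\geq T$. A strategy is overtaking optimal at $s$ if no strategy overtakes it at $s$. *)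

theory Defs
  imports "HOL-Probability.Probability"
begin

record ('s, 'a) mdp =
  avail :: "'s \<Rightarrow> 'a set"
  trans_prob :: "'s \<Rightarrow> 'a \<Rightarrow> 's pmf"

text \<open>
  A history \<open>(s\<^sub>1, a\<^sub>1, \<dots>, s\<^bsub>t-1\<^esub>, a\<^bsub>t-1\<^esub>, s\<^sub>t)\<close> is represented by the list
  \<open>[(s\<^sub>1, a\<^sub>1), \<dots>, (s\<^bsub>t-1\<^esub>, a\<^bsub>t-1\<^esub>)]\<close> together with the current state \<open>s\<^sub>t\<close>.
\<close>

inductive is_history :: "('s, 'a) mdp \<Rightarrow> ('s \<times> 'a) list \<Rightarrow> 's \<Rightarrow> bool" for M where
  start: "is_history M [] s"
| step: "is_history M h s \<Longrightarrow> a \<in> avail M s \<Longrightarrow> s' \<in> set_pmf (trans_prob M s a)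
    \<Longrightarrow> is_history M (h @ [(s, a)]) s'"

type_synonym ('s, 'a) strat = "('s \<times> 'a) list \<Rightarrow> 's \<Rightarrow> 'a pmf"

definition strategy :: "('s, 'a) mdp \<Rightarrow> ('s, 'a) strat \<Rightarrow> bool" where
  "strategy M \<sigma> \<longleftrightarrow> (\<forall>h s. is_history M h s \<longrightarrow> set_pmf (\<sigma> h s) \<subseteq> avail M s)"

text \<open>
  Infinite histories are functions \<open>\<omega> :: nat \<Rightarrow> 's \<times> 'a\<close> where \<open>\<omega> n\<close> is the state-action pair
  of period \<open>n + 1\<close>.  Given the pairs of the first \<open>n\<close> periods, \<^term>\<open>next_pair M \<sigma> s n \<omega>\<close> is the
  distribution of the pair of period \<open>n + 1\<close>; the probability measure on infinite histories is
  the one obtained from these kernels by the Ionescu-Tulcea theorem.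
\<close>

definition next_state :: "('s, 'a) mdp \<Rightarrow> 's \<Rightarrow> nat \<Rightarrow> (nat \<Rightarrow> 's \<times> 'a) \<Rightarrow> 's pmf" where
  "next_state M s n \<omega> =
    (case n of 0 \<Rightarrow> return_pmf s | Suc m \<Rightarrow> trans_prob M (fst (\<omega> m)) (snd (\<omega> m)))"

definition next_pair ::
  "('s, 'a) mdp \<Rightarrow> ('s, 'a) strat \<Rightarrow> 's \<Rightarrow> nat \<Rightarrow> (nat \<Rightarrow> 's \<times> 'a) \<Rightarrow> ('s \<times> 'a) pmf" where
  "next_pair M \<sigma> s n \<omega> =
    bind_pmf (next_state M s n \<omega>) (\<lambda>s'. map_pmf (Pair s') (\<sigma> (map \<omega> [0..<n]) s'))"

abbreviation kernel ::
  "('s, 'a) mdp \<Rightarrow> ('s, 'a) strat \<Rightarrow> 's \<Rightarrow> nat \<Rightarrow> (nat \<Rightarrow> 's \<times> 'a) \<Rightarrow> ('s \<times> 'a) measure" where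
  "kernel M \<sigma> s \<equiv> (\<lambda>n \<omega>. measure_pmf (next_pair M \<sigma> s n \<omega>))"

definition path_measure ::
  "('s, 'a) mdp \<Rightarrow> ('s, 'a) strat \<Rightarrow> 's \<Rightarrow> (nat \<Rightarrow> 's \<times> 'a) measure" where
  "path_measure M \<sigma> s = projective_family.lim UNIV
     (Ionescu_Tulcea.CI (kernel M \<sigma> s) (\<lambda>_. count_space UNIV)) (\<lambda>_. count_space UNIV)"

lemma Ionescu_Tulcea_kernel:
  fixes M :: "('s :: countable, 'a :: countable) mdp"
  shows "Ionescu_Tulcea (kernel M \<sigma> s) (\<lambda>_. count_space UNIV)"
proof (rule Ionescu_Tulcea.intro)
  fix i :: nat
  have *: "PiM {0..<i} (\<lambda>_. count_space UNIV :: ('s \<times> 'a) measure)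
      = count_space (PiE {0..<i} (\<lambda>_. UNIV))"
    by (rule count_space_PiM_finite) auto
  show "kernel M \<sigma> s i \<in> PiM {0..<i} (\<lambda>_. count_space UNIV) \<rightarrow>\<^sub>M subprob_algebra (count_space UNIV)"
    unfolding * measurable_count_space_eq1
    by (simp add: space_subprob_algebra measure_pmf.subprob_space_axioms)
qed (rule measure_pmf.prob_space_axioms)

lemma prob_space_path_measure:
  fixes M :: "('s :: countable, 'a :: countable) mdp"
  shows "prob_space (path_measure M \<sigma> s)"
proof -
  interpret Ionescu_Tulcea "kernel M \<sigma> s" "\<lambda>_. count_space UNIV"
    by (rule Ionescu_Tulcea_kernel)
  have "prob_space (CI {})"
    by (rule PF.prob_space_P) auto
  then have "prob_space (distr PF.lim (PiM {} (\<lambda>_. count_space UNIV)) (\<lambda>x. restrict x {}))"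
    using distr_lim[of "{}"] by simp
  then have "prob_space PF.lim"
    by (rule prob_space_distrD[rotated])
      (simp add: measurable_cong_sets[OF PF.sets_lim refl] measurable_restrict_subset)
  then show ?thesis
    unfolding path_measure_def .
qed

lemma sets_path_measure:
  fixes M :: "('s :: countable, 'a :: countable) mdp"
  shows "sets (path_measure M \<sigma> s) = sets (PiM UNIV (\<lambda>_. count_space UNIV))"
proof -
  interpret Ionescu_Tulcea "kernel M \<sigma> s" "\<lambda>_. count_space UNIV"
    by (rule Ionescu_Tulcea_kernel)
  show ?thesis
    unfolding path_measure_def by simp
qed

text \<open>The first period (counted from 1) at which the state is \<open>g\<close>; the infimum over the empty set
  is \<open>\<infinity>\<close>.\<close>

definition first_visit :: "'s \<Rightarrow> (nat \<Rightarrow> 's \<times> 'a) \<Rightarrow> enat" where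
  "first_visit g \<omega> = (INF n \<in> {n. fst (\<omega> n) = g}. enat (Suc n))"

lemma first_visit_le_iff: "first_visit g \<omega> \<le> enat t \<longleftrightarrow> (\<exists>n<t. fst (\<omega> n) = g)"
proof
  assume *: "first_visit g \<omega> \<le> enat t"
  let ?A = "(\<lambda>n. enat (Suc n)) ` {n. fst (\<omega> n) = g}"
  have "?A \<noteq> {}"
  proof
    assume "?A = {}"
    then have "first_visit g \<omega> = \<infinity>"
      unfolding first_visit_def by (simp add: Inf_enat_def)
    with * show False
      by simp
  qed
  then obtain k where "k \<in> ?A"
    by blast
  then have "Inf ?A \<in> ?A"
    by (rule wellorder_InfI)
  then obtain n where n: "fst (\<omega> n) = g" "Inf ?A = enat (Suc n)"
    by blast
  have "enat (Suc n) \<le> enat t"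
    using * unfolding first_visit_def n(2) .
  with n(1) show "\<exists>n<t. fst (\<omega> n) = g"
    by (intro exI[of _ n]) simp
next
  assume "\<exists>n<t. fst (\<omega> n) = g"
  then obtain n where "n < t" "fst (\<omega> n) = g"
    by blast
  then show "first_visit g \<omega> \<le> enat t"
    unfolding first_visit_def by (intro INF_lower2[of n]) auto
qed

lemma first_visit_event:
  fixes M :: "('s :: countable, 'a :: countable) mdp"
  shows "{\<omega> \<in> space (path_measure M \<sigma> s). first_visit g \<omega> \<le> enat t} \<in> sets (path_measure M \<sigma> s)"
proof -
  let ?P = "PiM UNIV (\<lambda>_. count_space UNIV) :: (nat \<Rightarrow> 's \<times> 'a) measure"
  have "(\<lambda>\<omega>. \<omega> n) \<in> ?P \<rightarrow>\<^sub>M count_space UNIV" for n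
    by (rule measurable_component_singleton) simp
  then have "(\<lambda>\<omega>. \<omega> n) -` {p. fst p = g} \<inter> space ?P \<in> sets ?P" for n
    by (rule measurable_sets) simp
  then have "(\<Union>n<t. (\<lambda>\<omega>. \<omega> n) -` {p. fst p = g} \<inter> space ?P) \<in> sets ?P"
    by (intro sets.finite_UN) auto
  moreover have "(\<Union>n<t. (\<lambda>\<omega>. \<omega> n) -` {p. fst p = g} \<inter> space ?P)
      = {\<omega> \<in> space (path_measure M \<sigma> s). first_visit g \<omega> \<le> enat t}"
    unfolding first_visit_le_iff sets_eq_imp_space_eq[OF sets_path_measure] by blast
  ultimately show ?thesis
    by (simp only: sets_path_measure)
qed

text \<open>The safety objective: the parameter \<open>g\<close> is the state to be avoided.\<close>

definition overtakes ::
  "('s, 'a) mdp \<Rightarrow> 's \<Rightarrow> 's \<Rightarrow> ('s, 'a) strat \<Rightarrow> ('s, 'a) strat \<Rightarrow> bool" where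
  "overtakes M g s \<sigma> \<sigma>' \<longleftrightarrow>
    (\<exists>T::nat. \<forall>t\<ge>T.
      \<P>(\<omega> in path_measure M \<sigma> s. first_visit g \<omega> \<le> enat t)
        < \<P>(\<omega> in path_measure M \<sigma>' s. first_visit g \<omega> \<le> enat t))"

definition overtaking_optimal ::
  "('s, 'a) mdp \<Rightarrow> 's \<Rightarrow> 's \<Rightarrow> ('s, 'a) strat \<Rightarrow> bool" where
  "overtaking_optimal M g s \<sigma> \<longleftrightarrow>
    strategy M \<sigma> \<and> \<not> (\<exists>\<sigma>'. strategy M \<sigma>' \<and> overtakes M g s \<sigma>' \<sigma>)"

datatype ex_state = X | Y | Z | Bad

datatype ex_action = A | B | D | E | Stay

instance ex_state :: countable by countable_datatype
instance ex_action :: countable by countable_datatype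

text \<open>\<open>Bad\<close> is \<open>s\<^sup>*\<close>; its only action is the dummy action \<open>Stay\<close>, so that play continues forever.
  In \<open>ex_trans\<close> the last equation covers \<open>Stay\<close> in \<open>Bad\<close> and, irrelevantly, all pairs where the
  action is not available.\<close>

fun ex_avail :: "ex_state \<Rightarrow> ex_action set" where
  "ex_avail X = {A, B}"
| "ex_avail Y = {D}"
| "ex_avail Z = {E}"
| "ex_avail Bad = {Stay}"

fun ex_trans :: "ex_state \<Rightarrow> ex_action \<Rightarrow> ex_state pmf" where
  "ex_trans X A = map_pmf (\<lambda>b. if b then Bad else X) (bernoulli_pmf (1 / 2))"
| "ex_trans X B = return_pmf Y"
| "ex_trans Y D = map_pmf (\<lambda>b. if b then Bad else Z) (bernoulli_pmf (3 / 4))"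
| "ex_trans Z E = map_pmf (\<lambda>b. if b then Bad else Z) (bernoulli_pmf (1 / 2))"
| "ex_trans s _ = return_pmf s"

definition ex_mdp :: "(ex_state, ex_action) mdp" where
  "ex_mdp = \<lparr>avail = ex_avail, trans_prob = ex_trans\<rparr>"

end

(* Only the choices made after the histories (x,a,...,x,a,x) matter, so a strategy amounts to
   the weights w(n) with which it plays a exactly n times and then b (if s* is not reached before).
   Playing b at period n + 1 doubles the probability of being safe at period n + 2 and changes nothing
   at other periods, because the lottery 3/4 in y makes up for the skipped lottery in x.  Hence the
   probability of being safe through period n + 2 is (1 + w(n)) / 2^(n+1).  As w is summable, its
   tails are small, so some other weights with total at most 1 exceed w at all large n. *)
theory Submission
  imports Defs
begin

section \<open>Finite-dimensional laws of the path measure\<close>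

text \<open>A discrete stand-in for the path measure. Past the end of \<open>h\<close> the value of
  \<open>nth h\<close> is unspecified, which is harmless: \<open>next_pair\<close> at time
  \<open>n\<close> reads only indices below \<open>n\<close>
  (\<open>next_pair_cong\<close>).\<close>

primrec prefix_pmf :: "('s, 'a) mdp \<Rightarrow> ('s, 'a) strat \<Rightarrow> 's \<Rightarrow> nat \<Rightarrow> ('s \<times> 'a) list pmf" where
  "prefix_pmf M \<sigma> s 0 = return_pmf []"
| "prefix_pmf M \<sigma> s (Suc n) =
     bind_pmf (prefix_pmf M \<sigma> s n) (\<lambda>h. map_pmf (\<lambda>p. h @ [p]) (next_pair M \<sigma> s n (nth h)))"

lemma next_state_cong: "(\<And>i. i < n \<Longrightarrow> \<omega> i = \<omega>' i) \<Longrightarrow> next_state M s n \<omega> = next_state M s n \<omega>'"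
  unfolding next_state_def by (cases n) auto

lemma next_pair_cong:
  assumes "\<And>i. i < n \<Longrightarrow> \<omega> i = \<omega>' i"
  shows "next_pair M \<sigma> s n \<omega> = next_pair M \<sigma> s n \<omega>'"
proof -
  have "map \<omega> [0..<n] = map \<omega>' [0..<n]"
    using assms by auto
  with next_state_cong[of n \<omega> \<omega>' M s, OF assms] show ?thesis
    unfolding next_pair_def by (simp only:)
qed

context
  fixes M :: "('s :: countable, 'a :: countable) mdp" and \<sigma> :: "('s, 'a) strat" and s :: 's
begin

interpretation Ionescu_Tulcea "kernel M \<sigma> s" "\<lambda>_. count_space UNIV"
  by (rule Ionescu_Tulcea_kernel)

lemma PiM_count_space_Ico:
  "PiM {0..<n::nat} (\<lambda>_. count_space UNIV :: ('s \<times> 'a) measure) = count_space (PiE {0..<n} (\<lambda>_. UNIV))"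
  by (rule count_space_PiM_finite) auto

lemma measurable_prefix:
  "(\<lambda>\<omega>. map \<omega> [0..<n]) \<in> PiM {0..<n::nat} (\<lambda>_. count_space UNIV :: ('s \<times> 'a) measure) \<rightarrow>\<^sub>M count_space UNIV"
  unfolding PiM_count_space_Ico by simp

text \<open>Induction along the Ionescu-Tulcea construction, where \<open>C 0 (Suc n)\<close> binds
  \<open>C 0 n\<close> with \<open>eP n\<close>. The starting point
  \<open>\<lambda>_. undefined\<close> is the only element of the product over the empty index
  set.\<close>

lemma distr_C_prefix:
  "distr (C 0 n (\<lambda>_. undefined)) (count_space UNIV) (\<lambda>\<omega>. map \<omega> [0..<n]) = prefix_pmf M \<sigma> s n"
proof (induction n)
  case 0
  show ?case
    by (simp add: distr_return PiM_count_space_Ico return_pmf.rep_eq)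
next
  case (Suc n)
  let ?C = "C 0 n (\<lambda>_. undefined)"
  let ?K = "\<lambda>h. measure_pmf (map_pmf (\<lambda>p. h @ [p]) (next_pair M \<sigma> s n (nth h)))"
  have sets_C0: "sets ?C = sets (PiM {0..<n} (\<lambda>_. count_space UNIV))"
    using sets_C[of "\<lambda>_. undefined" 0 n] by simp
  have space_C0: "space ?C = space (PiM {0..<n} (\<lambda>_. count_space UNIV))"
    by (rule sets_eq_imp_space_eq[OF sets_C0])
  have ne: "space ?C \<noteq> {}"
    unfolding space_C0 by (simp add: space_PiM PiE_eq_empty_iff)
  \<comment> \<open>The extended list depends on \<open>\<omega>\<close> only through
    \<open>map \<omega> [0..<n]\<close>, so the bind factors through the push-forward to lists and
    the induction hypothesis applies.\<close>
  have step: "distr (eP n \<omega>) (count_space UNIV) (\<lambda>\<omega>. map \<omega> [0..<Suc n]) = ?K (map \<omega> [0..<n])"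
    if \<omega>: "\<omega> \<in> space ?C" for \<omega>
  proof -
    have upd: "fun_upd \<omega> n \<in> kernel M \<sigma> s n \<omega> \<rightarrow>\<^sub>M PiM {0..<Suc n} (\<lambda>_. count_space UNIV)"
      using \<omega> unfolding space_C0 PiM_count_space_Ico by (auto simp: PiE_iff extensional_def)
    have np: "next_pair M \<sigma> s n (nth (map \<omega> [0..<n])) = next_pair M \<sigma> s n \<omega>"
      by (rule next_pair_cong) simp
    have "distr (eP n \<omega>) (count_space UNIV) (\<lambda>\<omega>. map \<omega> [0..<Suc n])
        = distr (kernel M \<sigma> s n \<omega>) (count_space UNIV) (\<lambda>p. map (fun_upd \<omega> n p) [0..<Suc n])"
      unfolding eP_def by (subst distr_distr[OF measurable_prefix upd]) (simp add: comp_def)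
    also have "(\<lambda>p. map (fun_upd \<omega> n p) [0..<Suc n]) = (\<lambda>p. map \<omega> [0..<n] @ [p])"
      by (auto simp: fun_eq_iff)
    finally show ?thesis
      unfolding np map_pmf_rep_eq .
  qed
  have eP: "eP n \<in> ?C \<rightarrow>\<^sub>M subprob_algebra (PiM {0..<Suc n} (\<lambda>_. count_space UNIV))"
    unfolding measurable_cong_sets[OF sets_C0 refl] by (rule measurable_eP)
  have "distr (C 0 (Suc n) (\<lambda>_. undefined)) (count_space UNIV) (\<lambda>\<omega>. map \<omega> [0..<Suc n])
      = ?C \<bind> (\<lambda>\<omega>. distr (eP n \<omega>) (count_space UNIV) (\<lambda>\<omega>. map \<omega> [0..<Suc n]))"
    using distr_bind[OF eP ne measurable_prefix] by simp
  also have "\<dots> = ?C \<bind> (\<lambda>\<omega>. ?K (map \<omega> [0..<n]))"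
    by (rule bind_cong[OF refl step])
  also have "\<dots> = distr ?C (count_space UNIV) (\<lambda>\<omega>. map \<omega> [0..<n]) \<bind> ?K"
    by (rule bind_distr[symmetric, OF _ measurable_measure_pmf ne])
      (simp only: measurable_cong_sets[OF sets_C0 refl] measurable_prefix)
  also have "\<dots> = prefix_pmf M \<sigma> s (Suc n)"
    by (simp add: Suc.IH measure_pmf_bind)
  finally show ?case .
qed

lemma distr_path_measure_prefix:
  "distr (path_measure M \<sigma> s) (count_space UNIV) (\<lambda>\<omega>. map \<omega> [0..<n]) = prefix_pmf M \<sigma> s n"
proof -
  have restr: "(\<lambda>\<omega>. restrict \<omega> {0..<n}) \<in> path_measure M \<sigma> s \<rightarrow>\<^sub>M PiM {0..<n} (\<lambda>_. count_space UNIV)"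
    unfolding measurable_cong_sets[OF sets_path_measure refl]
    by (rule measurable_restrict_subset) simp
  \<comment> \<open>The index set is a full initial segment, so the embedding in
    \<open>emeasure_CI\<close> is the identity.\<close>
  have C_CI: "CI {0..<n} = C 0 n (\<lambda>_. undefined)"
  proof (rule measure_eqI)
    show "sets (CI {0..<n}) = sets (C 0 n (\<lambda>_. undefined))"
      unfolding CI_def using sets_C[of "\<lambda>_. undefined" 0 n] by simp
  next
    fix S assume "S \<in> sets (CI {0..<n})"
    then have S: "S \<in> sets (PiM {0..<n} (\<lambda>_. count_space UNIV))"
      unfolding CI_def by simp
    show "emeasure (CI {0..<n}) S = emeasure (C 0 n (\<lambda>_. undefined)) S"
      using emeasure_CI[OF subset_refl S] prod_emb_id[of S "{0..<n}" "\<lambda>_. count_space UNIV"]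
        sets.sets_into_space[OF S] by (simp add: space_PiM)
  qed
  have "distr (path_measure M \<sigma> s) (count_space UNIV) (\<lambda>\<omega>. map \<omega> [0..<n])
      = distr (path_measure M \<sigma> s) (count_space UNIV) (\<lambda>\<omega>. map (restrict \<omega> {0..<n}) [0..<n])"
    by (rule arg_cong[where f = "distr _ _"]) (auto simp: fun_eq_iff)
  also have "\<dots> = distr (distr (path_measure M \<sigma> s) (PiM {0..<n} (\<lambda>_. count_space UNIV))
      (\<lambda>\<omega>. restrict \<omega> {0..<n})) (count_space UNIV) (\<lambda>\<omega>. map \<omega> [0..<n])"
    by (subst distr_distr[OF measurable_prefix restr]) (simp add: comp_def)
  also have "distr (path_measure M \<sigma> s) (PiM {0..<n} (\<lambda>_. count_space UNIV))
      (\<lambda>\<omega>. restrict \<omega> {0..<n}) = CI {0..<n}"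
    unfolding path_measure_def by (rule distr_lim) simp
  finally show ?thesis
    unfolding C_CI distr_C_prefix .
qed

end

lemma length_prefix_pmf: "h \<in> set_pmf (prefix_pmf M \<sigma> s n) \<Longrightarrow> length h = n"
  by (induction n arbitrary: h) auto

section \<open>State laws per period and hitting probabilities of an absorbing state\<close>

definition state_pmf :: "('s, 'a) mdp \<Rightarrow> ('s, 'a) strat \<Rightarrow> 's \<Rightarrow> nat \<Rightarrow> 's pmf" where
  "state_pmf M \<sigma> s n = bind_pmf (prefix_pmf M \<sigma> s n) (\<lambda>h. next_state M s n (nth h))"

lemma map_nth_prefix: "h \<in> set_pmf (prefix_pmf M \<sigma> s n) \<Longrightarrow> map (nth h) [0..<n] = h"
  using length_prefix_pmf map_nth by metis

text \<open>A strategy is constrained only on histories of positive probability. This lemma makes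
  that constraint available on the support of the prefix law.\<close>

lemma prefix_pmf_is_history:
  assumes "strategy M \<sigma>"
  shows "h \<in> set_pmf (prefix_pmf M \<sigma> s n) \<Longrightarrow> s' \<in> set_pmf (next_state M s n (nth h)) \<Longrightarrow> is_history M h s'"
proof (induction n arbitrary: h s')
  case 0
  then show ?case
    by (simp add: is_history.start)
next
  case (Suc n)
  from Suc.prems(1) obtain g p where g: "g \<in> set_pmf (prefix_pmf M \<sigma> s n)"
    "p \<in> set_pmf (next_pair M \<sigma> s n (nth g))" "h = g @ [p]"
    by auto
  from g(2) obtain r a where p: "r \<in> set_pmf (next_state M s n (nth g))" "a \<in> set_pmf (\<sigma> g r)" "p = (r, a)"
    unfolding next_pair_def map_nth_prefix[OF g(1)] by auto
  have r: "is_history M g r"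
    by (rule Suc.IH[OF g(1) p(1)])
  then have "a \<in> avail M r"
    using assms p(2) unfolding strategy_def by blast
  moreover have "s' \<in> set_pmf (trans_prob M r a)"
    using Suc.prems(2) length_prefix_pmf[OF g(1)] unfolding g(3) p(3) next_state_def
    by (simp add: nth_append)
  ultimately show ?case
    unfolding g(3) p(3) using r by (intro is_history.step)
qed

lemma state_pmf_0: "state_pmf M \<sigma> s 0 = return_pmf s"
  unfolding state_pmf_def by (simp add: bind_return_pmf next_state_def)

lemma state_pmf_Suc:
  "state_pmf M \<sigma> s (Suc n) = bind_pmf (prefix_pmf M \<sigma> s n) (\<lambda>h. bind_pmf (next_state M s n (nth h))
     (\<lambda>s'. bind_pmf (\<sigma> h s') (trans_prob M s')))"
  unfolding state_pmf_def prefix_pmf.simps bind_assoc_pmf bind_map_pmf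
  by (rule bind_pmf_cong[OF refl])
    (simp add: next_pair_def map_nth_prefix length_prefix_pmf bind_assoc_pmf bind_map_pmf next_state_def nth_append)

text \<open>If the choice at one fixed time depends on the state alone, the rest of the history
  integrates out. Since \<open>n\<close> is fixed, \<open>\<rho>\<close> may differ from period to
  period.\<close>

lemma state_pmf_Suc_markov:
  assumes "strategy M \<sigma>"
    and "\<And>h s'. length h = n \<Longrightarrow> is_history M h s' \<Longrightarrow> \<sigma> h s' = \<rho> s'"
  shows "state_pmf M \<sigma> s (Suc n) = bind_pmf (state_pmf M \<sigma> s n) (\<lambda>s'. bind_pmf (\<rho> s') (trans_prob M s'))"
  unfolding state_pmf_Suc unfolding state_pmf_def bind_assoc_pmf
  by (intro bind_pmf_cong refl arg_cong[where f = "\<lambda>p. bind_pmf p _"] assms(2))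
    (auto intro: length_prefix_pmf prefix_pmf_is_history[OF assms(1)])

lemma map_last_prefix_pmf: "map_pmf (\<lambda>h. fst (last h)) (prefix_pmf M \<sigma> s (Suc n)) = state_pmf M \<sigma> s n"
  unfolding state_pmf_def prefix_pmf.simps map_bind_pmf
  by (rule bind_pmf_cong[OF refl])
    (simp add: next_pair_def map_bind_pmf pmf.map_comp comp_def map_pmf_const bind_return_pmf')

text \<open>Play never leaves an absorbing state, so having visited \<open>g\<close> by a period is
  almost surely the same as being in \<open>g\<close> at that period. Period \<open>Suc n\<close>
  has index \<open>n\<close> because indices start at 0.\<close>

lemma prob_first_visit_absorbing:
  fixes M :: "('s :: countable, 'a :: countable) mdp"
  assumes \<sigma>: "strategy M \<sigma>"
    and absorbing: "\<And>a. a \<in> avail M g \<Longrightarrow> trans_prob M g a = return_pmf g"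
  shows "\<P>(\<omega> in path_measure M \<sigma> s. first_visit g \<omega> \<le> enat (Suc n)) = pmf (state_pmf M \<sigma> s n) g"
proof -
  let ?m = "\<lambda>\<omega> :: nat \<Rightarrow> 's \<times> 'a. map \<omega> [0..<Suc n]"
  let ?S = "{h :: ('s \<times> 'a) list. g \<in> fst ` set h}"
  have prefix: "g \<in> fst ` set (map \<omega> [0..<k]) \<longleftrightarrow> (\<exists>i<k. fst (\<omega> i) = g)" for k and \<omega> :: "nat \<Rightarrow> 's \<times> 'a"
    unfolding set_map image_image by auto
  have abs: "is_history M h r \<Longrightarrow> g \<in> fst ` set h \<Longrightarrow> r = g" for h r
  proof (induction rule: is_history.induct)
    case (step h r a r')
    then have "r = g"
      by auto
    with step absorbing[of a] show ?case
      by auto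
  qed simp
  have meas: "?m \<in> path_measure M \<sigma> s \<rightarrow>\<^sub>M count_space UNIV"
  proof -
    have "(\<lambda>\<omega>. restrict \<omega> {0..<Suc n}) \<in> path_measure M \<sigma> s
        \<rightarrow>\<^sub>M PiM {0..<Suc n} (\<lambda>_. count_space UNIV)"
      unfolding measurable_cong_sets[OF sets_path_measure refl]
      by (rule measurable_restrict_subset) simp
    from measurable_compose[OF this measurable_prefix] show ?thesis
      by (rule measurable_cong[THEN iffD1, rotated]) simp
  qed
  have "\<P>(\<omega> in path_measure M \<sigma> s. first_visit g \<omega> \<le> enat (Suc n))
      = measure (path_measure M \<sigma> s) (?m -` ?S \<inter> space (path_measure M \<sigma> s))"
    by (rule arg_cong[where f = "measure _"]) (auto simp: first_visit_le_iff prefix simp del: upt_Suc)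
  also have "\<dots> = measure (prefix_pmf M \<sigma> s (Suc n)) ?S"
    unfolding distr_path_measure_prefix[symmetric] by (rule measure_distr[OF meas, symmetric]) simp
  also have "\<dots> = measure (prefix_pmf M \<sigma> s (Suc n)) ((\<lambda>h. fst (last h)) -` {g})"
  proof (rule measure_pmf.finite_measure_eq_AE)
    \<comment> \<open>The two events agree only on the support, since other lists may leave
      \<open>g\<close>.\<close>
    show "AE h in prefix_pmf M \<sigma> s (Suc n). (h \<in> ?S) = (h \<in> (\<lambda>h. fst (last h)) -` {g})"
    proof (rule AE_pmfI)
      fix h assume "h \<in> set_pmf (prefix_pmf M \<sigma> s (Suc n))"
      then obtain k p where k: "k \<in> set_pmf (prefix_pmf M \<sigma> s n)"
        "p \<in> set_pmf (next_pair M \<sigma> s n (nth k))" "h = k @ [p]"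
        by auto
      then have "is_history M k (fst p)"
        using prefix_pmf_is_history[OF \<sigma> k(1)] unfolding next_pair_def by auto
      then show "(h \<in> ?S) = (h \<in> (\<lambda>h. fst (last h)) -` {g})"
        using abs[of k "fst p"] k(3) by auto
    qed
  qed auto
  also have "\<dots> = pmf (state_pmf M \<sigma> s n) g"
    unfolding map_last_prefix_pmf[symmetric] pmf_map ..
  finally show ?thesis .
qed

section \<open>The example\<close>

lemma ex_mdp_simps [simp]: "avail ex_mdp = ex_avail" "trans_prob ex_mdp = ex_trans"
  unfolding ex_mdp_def by simp_all

text \<open>Among available actions, only \<open>A\<close> played in \<open>X\<close> can lead to
  \<open>X\<close>. Hence there is a single history of each length that ends in
  \<open>X\<close>.\<close>

lemma ex_history_X: "is_history ex_mdp h s \<Longrightarrow> s = X \<Longrightarrow> h = replicate (length h) (X, A)"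
proof (induction rule: is_history.induct)
  case (step h s a s')
  then have "s = X \<and> a = A"
    by (cases s) auto
  with step show ?case
    by (metis length_append_singleton replicate_Suc replicate_append_same)
qed simp

lemma ex_history_replicate: "is_history ex_mdp (replicate n (X, A)) X"
proof (induction n)
  case (Suc n)
  then have "is_history ex_mdp (replicate n (X, A) @ [(X, A)]) X"
    by (rule is_history.step) auto
  then show ?case
    by (simp add: replicate_append_same)
qed (simp add: is_history.start)

lemma UNIV_ex_state: "UNIV = {X, Y, Z, Bad}"
  using ex_state.exhaust by auto

lemma finite_ex_state: "finite (S :: ex_state set)"
  by (rule finite_subset[OF subset_UNIV]) (simp add: UNIV_ex_state)

section \<open>Switching weights and exact state probabilities\<close>

definition switch_prob :: "(ex_state, ex_action) strat \<Rightarrow> nat \<Rightarrow> real" where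
  "switch_prob \<sigma> n = pmf (\<sigma> (replicate n (X, A)) X) B"

text \<open>The weight of never playing \<open>B\<close> in the first \<open>n\<close> periods, conditional on the lotteries of
  \<open>A\<close> always returning to \<open>X\<close>; its decrement at \<open>n\<close> is the weight of switching after exactly
  \<open>n\<close> plays of \<open>A\<close>.\<close>

definition stay_weight :: "(ex_state, ex_action) strat \<Rightarrow> nat \<Rightarrow> real" where
  "stay_weight \<sigma> n = (\<Prod>i<n. 1 - switch_prob \<sigma> i)"

lemma pmf_map_if_bernoulli:
  assumes "0 \<le> p" "p \<le> 1" "u \<noteq> v"
  shows "pmf (map_pmf (\<lambda>b. if b then u else v) (bernoulli_pmf p)) w
    = (if w = u then p else if w = v then 1 - p else 0)"
proof -
  have "map_pmf (\<lambda>b. if b then u else v) (bernoulli_pmf p)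
    = bind_pmf (bernoulli_pmf p) (\<lambda>b. return_pmf (if b then u else v))"
    by (simp add: map_pmf_def)
  then show ?thesis
    using assms by (simp add: pmf_bind pmf_return)
qed

context
  fixes \<sigma> :: "(ex_state, ex_action) strat"
  assumes \<sigma>: "strategy ex_mdp \<sigma>"
begin

text \<open>Written as a function of time and state so that it can serve as \<open>\<rho>\<close> in
  \<open>state_pmf_Suc_markov\<close>.\<close>

fun ex_rule :: "nat \<Rightarrow> ex_state \<Rightarrow> ex_action pmf" where
  "ex_rule n X = \<sigma> (replicate n (X, A)) X"
| "ex_rule n Y = return_pmf D"
| "ex_rule n Z = return_pmf E"
| "ex_rule n Bad = return_pmf Stay"

lemma ex_rule:
  assumes "is_history ex_mdp h s"
  shows "\<sigma> h s = ex_rule (length h) s"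
proof (cases s)
  case X
  then show ?thesis
    using ex_history_X[OF assms] by simp
qed (use assms \<sigma> in \<open>force simp: strategy_def simp flip: set_pmf_subset_singleton\<close>)+

lemma ex_state_pmf_Suc:
  "pmf (state_pmf ex_mdp \<sigma> X (Suc n)) s' =
    (\<Sum>s\<in>{X, Y, Z, Bad}. pmf (state_pmf ex_mdp \<sigma> X n) s * pmf (bind_pmf (ex_rule n s) (ex_trans s)) s')"
proof -
  have "state_pmf ex_mdp \<sigma> X (Suc n)
      = bind_pmf (state_pmf ex_mdp \<sigma> X n) (\<lambda>s. bind_pmf (ex_rule n s) (ex_trans s))"
    using state_pmf_Suc_markov[OF \<sigma>, where \<rho> = "ex_rule n"] ex_rule by simp
  then show ?thesis
    by (simp only: pmf_bind) (subst integral_measure_pmf[of "{X, Y, Z, Bad}"],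
      use UNIV_ex_state in \<open>auto simp del: ex_rule.simps simp: finite_ex_state\<close>)
qed

lemma ex_rule_X: "pmf (bind_pmf (ex_rule n X) (ex_trans X)) s
    = (1 - switch_prob \<sigma> n) * pmf (ex_trans X A) s + switch_prob \<sigma> n * pmf (return_pmf Y) s"
proof -
  have sub: "set_pmf (\<sigma> (replicate n (X, A)) X) \<subseteq> {A, B}"
    using \<sigma> ex_history_replicate[of n] unfolding strategy_def by fastforce
  then have "(\<Sum>a\<in>{A, B}. pmf (\<sigma> (replicate n (X, A)) X) a) = 1"
    by (intro sum_pmf_eq_1) auto
  then have A: "pmf (\<sigma> (replicate n (X, A)) X) A = 1 - switch_prob \<sigma> n"
    unfolding switch_prob_def by simp
  have "pmf (bind_pmf (ex_rule n X) (ex_trans X)) s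
    = (\<Sum>a\<in>{A, B}. pmf (\<sigma> (replicate n (X, A)) X) a * pmf (ex_trans X a) s)"
    unfolding pmf_bind ex_rule.simps by (subst integral_measure_pmf[of "{A, B}"]) (use sub in auto)
  also have "\<dots> = pmf (\<sigma> (replicate n (X, A)) X) A * pmf (ex_trans X A) s
    + pmf (\<sigma> (replicate n (X, A)) X) B * pmf (ex_trans X B) s"
    by (subst sum.insert) (simp_all del: ex_trans.simps)
  finally show ?thesis
    unfolding A by (simp only: switch_prob_def ex_trans.simps)
qed

text \<open>Each play of \<open>A\<close> halves the mass in \<open>X\<close>. Mass that switches
  reaches \<open>Y\<close> unhalved, and the factor 1/4 on leaving \<open>Y\<close> then equals two
  halvings, so in \<open>Z\<close> all switched weight carries the same power of 1/2, whenever the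
  switch was made.\<close>

lemma ex_state_pmf:
  shows state_pmf_X: "pmf (state_pmf ex_mdp \<sigma> X n) X = stay_weight \<sigma> n / 2 ^ n"
    and state_pmf_Y: "pmf (state_pmf ex_mdp \<sigma> X (Suc n)) Y = (stay_weight \<sigma> n - stay_weight \<sigma> (Suc n)) / 2 ^ n"
    and state_pmf_Z: "pmf (state_pmf ex_mdp \<sigma> X (Suc n)) Z = (1 - stay_weight \<sigma> n) / 2 ^ (Suc n)"
proof -
  note [simp del] = ex_rule.simps(1)
  note step = ex_state_pmf_Suc ex_rule_X bind_return_pmf pmf_map_if_bernoulli pmf_return
  show X: "pmf (state_pmf ex_mdp \<sigma> X n) X = stay_weight \<sigma> n / 2 ^ n" for n
    by (induction n) (simp_all add: state_pmf_0 step stay_weight_def)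
  show Y: "pmf (state_pmf ex_mdp \<sigma> X (Suc n)) Y = (stay_weight \<sigma> n - stay_weight \<sigma> (Suc n)) / 2 ^ n" for n
    by (simp add: step X) (simp add: stay_weight_def field_simps)
  show "pmf (state_pmf ex_mdp \<sigma> X (Suc n)) Z = (1 - stay_weight \<sigma> n) / 2 ^ (Suc n)"
  proof (induction n)
    case 0
    then show ?case
      by (simp add: step state_pmf_0 stay_weight_def)
  next
    case (Suc n)
    have "pmf (state_pmf ex_mdp \<sigma> X (Suc (Suc n))) Z
      = pmf (state_pmf ex_mdp \<sigma> X (Suc n)) Y / 4 + pmf (state_pmf ex_mdp \<sigma> X (Suc n)) Z / 2"
      by (simp add: ex_state_pmf_Suc[of "Suc n"] ex_rule_X bind_return_pmf pmf_map_if_bernoulli pmf_return)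
    also have "\<dots> = (1 - stay_weight \<sigma> (Suc n)) / 2 ^ (Suc (Suc n))"
      unfolding Y Suc.IH by (simp add: field_simps)
    finally show ?case .
  qed
qed

text \<open>Adding the masses in \<open>X\<close>, \<open>Y\<close> and \<open>Z\<close> telescopes,
  except that the mass in \<open>Y\<close> counts twice relative to \<open>2 ^ Suc n\<close>. This
  leaves the decrement of \<open>stay_weight\<close> as the only dependence on the strategy.\<close>

lemma prob_reach_Bad:
  "\<P>(\<omega> in path_measure ex_mdp \<sigma> X. first_visit Bad \<omega> \<le> enat (Suc (Suc n)))
    = 1 - (1 + (stay_weight \<sigma> n - stay_weight \<sigma> (Suc n))) / 2 ^ Suc n"
proof -
  have "(\<Sum>s\<in>{X, Y, Z, Bad}. pmf (state_pmf ex_mdp \<sigma> X (Suc n)) s) = 1"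
    by (rule sum_pmf_eq_1) (use UNIV_ex_state in \<open>auto simp: finite_ex_state\<close>)
  then have "pmf (state_pmf ex_mdp \<sigma> X (Suc n)) Bad
      = 1 - (stay_weight \<sigma> (Suc n) / 2 ^ Suc n + (stay_weight \<sigma> n - stay_weight \<sigma> (Suc n)) / 2 ^ n
        + (1 - stay_weight \<sigma> n) / 2 ^ Suc n)"
    by (simp add: state_pmf_X state_pmf_Y state_pmf_Z)
  also have "\<dots> = 1 - (1 + (stay_weight \<sigma> n - stay_weight \<sigma> (Suc n))) / 2 ^ Suc n"
    by (simp add: field_simps)
  finally show ?thesis
    by (subst prob_first_visit_absorbing[OF \<sigma>]) auto
qed

end

section \<open>Comparison and realization of weight sequences\<close>

lemma overtakes_ex_mdp:
  assumes "strategy ex_mdp \<sigma>" "strategy ex_mdp \<sigma>'"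
    and "\<And>n. n \<ge> N \<Longrightarrow>
      stay_weight \<sigma>' n - stay_weight \<sigma>' (Suc n) < stay_weight \<sigma> n - stay_weight \<sigma> (Suc n)"
  shows "overtakes ex_mdp Bad X \<sigma> \<sigma>'"
  unfolding overtakes_def
proof (intro exI[of _ "Suc (Suc N)"] allI impI)
  fix t assume "Suc (Suc N) \<le> t"
  then obtain n where "t = Suc (Suc n)" "N \<le> n"
    by (metis Suc_le_D Suc_le_mono)
  then show "\<P>(\<omega> in path_measure ex_mdp \<sigma> X. first_visit Bad \<omega> \<le> enat t)
      < \<P>(\<omega> in path_measure ex_mdp \<sigma>' X. first_visit Bad \<omega> \<le> enat t)"
    using assms(3)[of n] by (simp add: prob_reach_Bad assms(1,2) divide_strict_right_mono)
qed

lemma decseq_stay_weight: "decseq (stay_weight \<sigma>)"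
  and stay_weight_nonneg: "0 \<le> stay_weight \<sigma> n"
proof -
  have *: "0 \<le> stay_weight \<sigma> n" for n
    unfolding stay_weight_def switch_prob_def by (intro prod_nonneg) (simp add: pmf_le_1)
  then show "0 \<le> stay_weight \<sigma> n" .
  have "stay_weight \<sigma> (Suc n) = stay_weight \<sigma> n * (1 - switch_prob \<sigma> n)" for n
    by (simp add: stay_weight_def)
  with * show "decseq (stay_weight \<sigma>)"
    by (intro decseq_SucI) (simp add: mult_left_le switch_prob_def)
qed

lemma ex_strategy_with_stay_weight:
  fixes V :: "nat \<Rightarrow> real"
  assumes "V 0 = 1" "decseq V" "\<And>n. 0 < V n"
  obtains \<sigma> where "strategy ex_mdp \<sigma>" "stay_weight \<sigma> = V"
proof
  \<comment> \<open>The conditional probability of switching at time \<open>n\<close>, chosen so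
    that the product of the factors \<open>1 - \<beta> i\<close> telescopes to
    \<open>V n / V 0\<close>. Positivity of \<open>V\<close> makes the quotients meaningful.\<close>
  define \<beta> where "\<beta> n = 1 - V (Suc n) / V n" for n
  define \<sigma> :: "(ex_state, ex_action) strat" where
    "\<sigma> h s = (case s of X \<Rightarrow> map_pmf (\<lambda>b. if b then B else A) (bernoulli_pmf (\<beta> (length h)))
      | Y \<Rightarrow> return_pmf D | Z \<Rightarrow> return_pmf E | Bad \<Rightarrow> return_pmf Stay)" for h s
  show "strategy ex_mdp \<sigma>"
    unfolding strategy_def \<sigma>_def by (auto split: ex_state.split)
  have "0 \<le> \<beta> n" "\<beta> n \<le> 1" for n
    using assms(3)[of n] assms(3)[of "Suc n"] decseqD[OF assms(2), of n "Suc n"]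
    by (simp_all add: \<beta>_def)
  then have \<beta>: "switch_prob \<sigma> n = \<beta> n" for n
    by (simp add: switch_prob_def \<sigma>_def pmf_map_if_bernoulli)
  have "stay_weight \<sigma> n = V n" for n
  proof (induction n)
    case (Suc n)
    then show ?case
      using assms(3)[of n] by (simp add: stay_weight_def \<beta>) (simp add: \<beta>_def)
  qed (simp add: stay_weight_def assms(1))
  then show "stay_weight \<sigma> = V" ..
qed

theorem mainTheorem8:
  shows "\<not> (\<exists>\<sigma>. overtaking_optimal ex_mdp Bad X \<sigma>)"
proof
  assume "\<exists>\<sigma>. overtaking_optimal ex_mdp Bad X \<sigma>"
  then obtain \<sigma> where \<sigma>: "strategy ex_mdp \<sigma>"
    and opt: "\<And>\<sigma>'. strategy ex_mdp \<sigma>' \<Longrightarrow> \<not> overtakes ex_mdp Bad X \<sigma>' \<sigma>"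
    unfolding overtaking_optimal_def by blast
  let ?W = "stay_weight \<sigma>"
  \<comment> \<open>\<open>L\<close> is the weight of never switching, so \<open>?W n - L\<close> is
    the total weight of switches from time \<open>n\<close> on.\<close>
  obtain L where L: "?W \<longlonglongrightarrow> L" "\<And>n. L \<le> ?W n"
    using decseq_convergent[OF decseq_stay_weight, of 0 \<sigma>] stay_weight_nonneg by blast
  have "eventually (\<lambda>n. ?W n < L + 1 / 2) sequentially"
    by (rule order_tendstoD(2)[OF L(1)]) simp
  then obtain N where N: "?W N < L + 1 / 2"
    by (auto simp: eventually_sequentially)
  \<comment> \<open>Never switch before time \<open>N\<close>. After time \<open>N\<close>, add to
    each switching weight of \<open>\<sigma>\<close> a geometric amount, of total 1/2 from time
    \<open>Suc N\<close> on; the switch at time \<open>N\<close> absorbs the remaining weight. The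
    geometric term also keeps \<open>V\<close> positive.\<close>
  define V where "V n = (if n \<le> N then 1 else ?W n - L + (1 / 2) ^ (n - N))" for n
  have V_Suc: "V n - V (Suc n) = ?W n - ?W (Suc n) + (1 / 2) ^ (Suc n - N)" if "N < n" for n
    using that by (simp add: V_def Suc_diff_le)
  have "V (Suc n) \<le> V n" for n
  proof (cases n N rule: linorder_cases)
    \<comment> \<open>The choice of \<open>N\<close> enters here: \<open>V\<close> falls from 1 to
      \<open>?W (Suc N) - L + 1 / 2\<close>, and the tail is below 1/2.\<close>
    case equal
    then show ?thesis
      using N decseqD[OF decseq_stay_weight, of n "Suc n" \<sigma>] by (simp add: V_def)
  next
    case greater
    then show ?thesis
      using V_Suc[of n] decseqD[OF decseq_stay_weight, of n "Suc n" \<sigma>]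
        zero_le_power[of "1 / 2 :: real" "Suc n - N"] by linarith
  qed (simp add: V_def)
  moreover have "0 < V n" for n
    using L(2)[of n] by (simp add: V_def add_nonneg_pos)
  ultimately obtain \<sigma>' where \<sigma>': "strategy ex_mdp \<sigma>'" "stay_weight \<sigma>' = V"
    using ex_strategy_with_stay_weight[of V] by (auto simp: V_def decseq_SucI)
  have "overtakes ex_mdp Bad X \<sigma>' \<sigma>"
  proof (rule overtakes_ex_mdp[OF \<sigma>'(1) \<sigma>])
    \<comment> \<open>The comparison starts at \<open>Suc N\<close> because the decrement of
      \<open>V\<close> at \<open>N\<close> is merely the leftover weight, which may be smaller than
      that of \<open>\<sigma>\<close>.\<close>
    show "?W n - ?W (Suc n) < stay_weight \<sigma>' n - stay_weight \<sigma>' (Suc n)" if "n \<ge> Suc N" for n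
      using V_Suc[of n] that by (simp add: \<sigma>'(2))
  qed
  with opt[OF \<sigma>'(1)] show False
    by blast
qed

end
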